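(* Let $\lambda\in\mathbb{C}$ with $\lambda^3\notin\sigma(L_0)$ and let $f\in L^2_{\mathbb{C}}(0,1)$. For $x,t\in[0,1]$ put $$K(x,t)=d(-\mathrm{i}\lambda t)c(\mathrm{i}\lambda(x-1))+s(-\mathrm{i}\lambda t)s(\mathrm{i}\lambda(x-1))+c(-\mathrm{i}\lambda t)d(\mathrm{i}\lambda(x-1))+d(\mathrm{i}\lambda x)c(\mathrm{i}\lambda(1-t))+s(\mathrm{i}\lambda x)s(\mathrm{i}\lambda(1-t))+c(\mathrm{i}\lambda x)d(\mathrm{i}\lambda(1-t)).$$ Then the resolvent $R_{L_0}(\lambda^3)=(L_0-\lambda^3 I)^{-1}$ is given by $$(R_{L_0}(\lambda^3)f)(x)=\frac{-\mathrm{i}}{\lambda^2\Delta(0,\lambda)}\int_0^x\{d(\mathrm{i}\lambda(x-t))[1-3c(\mathrm{i}\lambda)]+K(x,t)\}f(t)\,dt+\frac{-\mathrm{i}}{\lambda^2\Delta(0,\lambda)}\int_x^1\{d(\mathrm{i}\lambda(x-t))[1-3c(-\mathrm{i}\lambda)]+K(x,t)\}f(t)\,dt .$$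
   Context: $L_0$ is the operator in $L^2_{\mathbb{C}}(0,1)$ given by $(L_0y)(x)=\mathrm{i}y'''(x)$ with domain $\{y\in W_3^2(0,1): y(1)=y(0),\ y'(1)=y'(0),\ y''(1)=y''(0)\}$, where $W_3^2(0,1)$ is the Sobolev space of functions with three derivatives in $L^2$; $\sigma(L_0)$ is its spectrum. With $\omega=\mathrm{e}^{2\pi\mathrm{i}/3}$, $$c(z)=\frac13\sum_{k=1}^3\mathrm{e}^{\omega^kz},\quad s(z)=\frac13\sum_{k=1}^3\frac{1}{\omega^k}\mathrm{e}^{\omega^kz},\quad d(z)=\frac13\sum_{k=1}^3\omega^k\mathrm{e}^{\omega^kz},$$ and $\Delta(0,\lambda)=3[c(\mathrm{i}\lambda)-c(-\mathrm{i}\lambda)]$ is the characteristic function of $L_0$. *)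

theory Defs
  imports "HOL-Analysis.Analysis"
begin

subsection \<open>The Hilbert space of square-integrable complex functions on (0,1)\<close>

definition square_integrable :: "(real \<Rightarrow> complex) \<Rightarrow> bool" where
  "square_integrable f \<longleftrightarrow>
     f \<in> borel_measurable (lebesgue_on {0<..<1}) \<and>
     integrable (lebesgue_on {0<..<1}) (\<lambda>x. (cmod (f x))\<^sup>2)"

definition L2_rel :: "(real \<Rightarrow> complex) \<Rightarrow> (real \<Rightarrow> complex) \<Rightarrow> bool" where
  "L2_rel f g \<longleftrightarrow> square_integrable f \<and> square_integrable g \<and>
     (AE x in lebesgue_on {0<..<1}. f x = g x)"

lemma square_integrable_zero: "square_integrable (\<lambda>x. 0)"
  by (simp add: square_integrable_def)

lemma square_integrable_scale:
  assumes "square_integrable f"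
  shows "square_integrable (\<lambda>x. a * f x)"
  using assms by (auto simp: square_integrable_def norm_mult power_mult_distrib)

lemma square_integrable_diff:
  assumes f: "square_integrable f" and g: "square_integrable g"
  shows "square_integrable (\<lambda>x. f x - g x)"
proof -
  have meas: "(\<lambda>x. f x - g x) \<in> borel_measurable (lebesgue_on {0<..<1})"
    using f g by (auto simp: square_integrable_def)
  have bound: "(cmod (u - v))\<^sup>2 \<le> 2 * (cmod u)\<^sup>2 + 2 * (cmod v)\<^sup>2" for u v
  proof -
    have "(cmod (u - v))\<^sup>2 \<le> (cmod u + cmod v)\<^sup>2"
      by (intro power_mono norm_triangle_ineq4) auto
    also have "\<dots> \<le> 2 * (cmod u)\<^sup>2 + 2 * (cmod v)\<^sup>2"
      using sum_squares_bound[of "cmod u" "cmod v"]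
      by (simp add: power2_sum)
    finally show ?thesis .
  qed
  have "integrable (lebesgue_on {0<..<1}) (\<lambda>x. (cmod (f x - g x))\<^sup>2)"
  proof (rule Bochner_Integration.integrable_bound)
    show "integrable (lebesgue_on {0<..<1}) (\<lambda>x. 2 * (cmod (f x))\<^sup>2 + 2 * (cmod (g x))\<^sup>2)"
      using f g by (auto simp: square_integrable_def)
    show "(\<lambda>x. (cmod (f x - g x))\<^sup>2) \<in> borel_measurable (lebesgue_on {0<..<1})"
      using meas by measurable
    show "AE x in lebesgue_on {0<..<1}.
        norm ((cmod (f x - g x))\<^sup>2) \<le> norm (2 * (cmod (f x))\<^sup>2 + 2 * (cmod (g x))\<^sup>2)"
      using bound by auto
  qed
  with meas show ?thesis by (simp add: square_integrable_def)
qed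

quotient_type L2c = "real \<Rightarrow> complex" / partial: L2_rel
proof (rule part_equivpI)
  show "\<exists>f. L2_rel f f"
    using square_integrable_zero by (auto simp: L2_rel_def)
  show "symp L2_rel"
    by (auto simp: symp_def L2_rel_def eq_commute)
  show "transp L2_rel"
    by (auto simp: transp_def L2_rel_def elim: AE_mp)
qed

instantiation L2c :: minus
begin

lift_definition minus_L2c :: "L2c \<Rightarrow> L2c \<Rightarrow> L2c" is "\<lambda>f g x. f x - g x"
  by (auto simp: L2_rel_def intro: square_integrable_diff)

instance ..

end

lift_definition scaleC :: "complex \<Rightarrow> L2c \<Rightarrow> L2c" (infixr "*\<^sub>C" 75) is "\<lambda>a f x. a * f x"
  by (auto simp: L2_rel_def intro: square_integrable_scale)

lift_definition norm_L2 :: "L2c \<Rightarrow> real" is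
  "\<lambda>f. sqrt (integral\<^sup>L (lebesgue_on {0<..<1}) (\<lambda>x. (cmod (f x))\<^sup>2))"
proof -
  fix f g assume "L2_rel f g"
  then show "sqrt (integral\<^sup>L (lebesgue_on {0<..<1}) (\<lambda>x. (cmod (f x))\<^sup>2)) =
      sqrt (integral\<^sup>L (lebesgue_on {0<..<1}) (\<lambda>x. (cmod (g x))\<^sup>2))"
    by (auto simp: L2_rel_def square_integrable_def
        intro!: arg_cong[where f = sqrt] integral_cong_AE)
qed

subsection \<open>Spectrum and resolvent of an unbounded operator\<close>

text \<open>An unbounded operator \<open>T\<close> is represented by its graph: \<open>(y, g) \<in> T\<close> says that
  \<open>y\<close> is in the domain and \<open>T y = g\<close>.\<close>

type_synonym L2_op = "(L2c \<times> L2c) set"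

text \<open>\<open>z\<close> is in the resolvent set iff \<open>T - z I\<close> maps the domain of \<open>T\<close> bijectively onto
  the whole space and has a bounded inverse.\<close>

definition resolvent_set :: "L2_op \<Rightarrow> complex set" where
  "resolvent_set T = {z.
     (\<forall>f. \<exists>!y. \<exists>g. (y, g) \<in> T \<and> g - z *\<^sub>C y = f) \<and>
     (\<exists>B. \<forall>y g. (y, g) \<in> T \<longrightarrow> norm_L2 y \<le> B * norm_L2 (g - z *\<^sub>C y))}"

definition spectrum :: "L2_op \<Rightarrow> complex set" where
  "spectrum T = - resolvent_set T"

definition resolvent :: "L2_op \<Rightarrow> complex \<Rightarrow> L2c \<Rightarrow> L2c" where
  "resolvent T z f = (THE y. \<exists>g. (y, g) \<in> T \<and> g - z *\<^sub>C y = f)"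

subsection \<open>The operator \<open>L\<^sub>0\<close>\<close>

definition test_function :: "(real \<Rightarrow> real) \<Rightarrow> bool" where
  "test_function \<phi> \<longleftrightarrow>
     (\<forall>n x. (deriv ^^ n) \<phi> field_differentiable at x) \<and>
     closure {x. \<phi> x \<noteq> 0} \<subseteq> {0<..<1}"

text \<open>Real-valued test functions suffice by linearity.\<close>

definition weak_deriv :: "L2c \<Rightarrow> L2c \<Rightarrow> bool" where
  "weak_deriv u v \<longleftrightarrow> (\<forall>\<phi>. test_function \<phi> \<longrightarrow>
     integral\<^sup>L (lebesgue_on {0<..<1}) (\<lambda>x. rep_L2c u x * of_real (deriv \<phi> x)) =
     - integral\<^sup>L (lebesgue_on {0<..<1}) (\<lambda>x. rep_L2c v x * of_real (\<phi> x)))"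

text \<open>The values at 0 and 1 of a class are those of its continuous representative on \<open>[0,1]\<close>;
  this representative exists and is unique whenever the class has a weak derivative
  in the space.\<close>

definition periodic_boundary :: "L2c \<Rightarrow> bool" where
  "periodic_boundary u \<longleftrightarrow> (\<exists>v. continuous_on {0..1} v \<and>
     (AE x in lebesgue_on {0<..<1}. rep_L2c u x = v x) \<and> v 1 = v 0)"

text \<open>The classes \<open>y1\<close>, \<open>y2\<close>, \<open>y3\<close> are the weak derivatives \<open>y'\<close>, \<open>y''\<close>, \<open>y'''\<close>; their
  existence in the space is membership of \<open>y\<close> in the Sobolev space \<open>W\<close> of order 3.
  Weak derivatives being unique, this is the graph of a function.\<close>

definition L0 :: L2_op where
  "L0 = {(y, \<i> *\<^sub>C y3) | y y1 y2 y3.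
     weak_deriv y y1 \<and> weak_deriv y1 y2 \<and> weak_deriv y2 y3 \<and>
     periodic_boundary y \<and> periodic_boundary y1 \<and> periodic_boundary y2}"

subsection \<open>Generalised trigonometric functions and the characteristic function\<close>

definition \<omega> :: complex where
  "\<omega> = exp (2 * of_real pi * \<i> / 3)"

definition c3 :: "complex \<Rightarrow> complex" where
  "c3 z = 1 / 3 * (\<Sum>k=1..3. exp (\<omega> ^ k * z))"

definition s3 :: "complex \<Rightarrow> complex" where
  "s3 z = 1 / 3 * (\<Sum>k=1..3. 1 / \<omega> ^ k * exp (\<omega> ^ k * z))"

definition d3 :: "complex \<Rightarrow> complex" where
  "d3 z = 1 / 3 * (\<Sum>k=1..3. \<omega> ^ k * exp (\<omega> ^ k * z))"

definition \<Delta>\<^sub>0 :: "complex \<Rightarrow> complex" where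
  "\<Delta>\<^sub>0 l = 3 * (c3 (\<i> * l) - c3 (- \<i> * l))"

definition K :: "complex \<Rightarrow> real \<Rightarrow> real \<Rightarrow> complex" where
  "K l x t =
     d3 (- \<i> * l * of_real t) * c3 (\<i> * l * of_real (x - 1)) +
     s3 (- \<i> * l * of_real t) * s3 (\<i> * l * of_real (x - 1)) +
     c3 (- \<i> * l * of_real t) * d3 (\<i> * l * of_real (x - 1)) +
     d3 (\<i> * l * of_real x) * c3 (\<i> * l * of_real (1 - t)) +
     s3 (\<i> * l * of_real x) * s3 (\<i> * l * of_real (1 - t)) +
     c3 (\<i> * l * of_real x) * d3 (\<i> * l * of_real (1 - t))"

end

theory Submission
  imports Defs
begin

text \<open>
  Put \<open>\<mu> = \<i>l\<close> and \<open>p\<^sub>k = \<omega>\<^sup>k\<mu>\<close>. By the addition theorem for \<open>d\<close>, \<open>K(x,t) = d(\<mu>(x-t-1)) + d(\<mu>(x-t+1))\<close>,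
  so the right-hand side is a linear combination \<open>u\<close>, with weights proportional to \<open>\<omega>\<^sup>k\<close>, of three
  solutions \<open>w\<^sub>k\<close> of the first-order equations \<open>w' = p\<^sub>k w - \<Delta>f\<close>. The numbers \<open>exp p\<^sub>k\<close> are the roots of
  \<open>X\<^sup>3 - 3c(\<mu>)X\<^sup>2 + 3c(-\<mu>)X - 1\<close>, and this cubic equation is exactly the periodicity of \<open>w\<^sub>k\<close>. Since
  \<open>\<Sum>\<omega>\<^sup>k = \<Sum>\<omega>\<^sup>2\<^sup>k = 0\<close>, the function \<open>f\<close> enters only in the third weak derivative of \<open>u\<close>, so \<open>u\<close> lies in the domain
  of \<open>L\<^sub>0\<close> and \<open>(L\<^sub>0 - l\<^sup>3)u = f\<close>. Finally \<open>\<Delta> \<noteq> 0\<close> and \<open>l \<noteq> 0\<close>: the value of the cubic at \<open>X = 1\<close> is \<open>-\<Delta>\<close>, and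
  if some \<open>exp p\<^sub>k = 1\<close>, then \<open>exp (p\<^sub>k x)\<close> is an eigenfunction for the eigenvalue \<open>l\<^sup>3\<close>.
\<close>

subsection \<open>Weak derivatives of primitives\<close>

lemma continuous_on_integrable:
  fixes k :: "real \<Rightarrow> complex"
  assumes "continuous_on {a..b} k"
  shows "integrable (lebesgue_on {a<..<b}) k"
proof -
  have "k absolutely_integrable_on {a<..<b}"
    using absolutely_integrable_continuous_real[OF assms] absolutely_integrable_on_open_interval[of a b k]
    by (simp add: box_real)
  then show ?thesis by (simp add: integrable_restrict_space set_integrable_def)
qed

lemma set_integrable_closed_interval:
  fixes h :: "real \<Rightarrow> complex"
  assumes "integrable (lebesgue_on {a<..<b}) h"
  shows "set_integrable lebesgue {a..b} h"
proof -
  have "set_integrable lebesgue {a<..<b} h"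
    using assms by (simp add: integrable_restrict_space set_integrable_def)
  then show ?thesis
    using absolutely_integrable_on_open_interval[of a b h] by (simp add: box_real)
qed

text \<open>Integration by parts via Fubini: the library versions need a pointwise derivative of the
  primitive off a countable set, which an \<open>L\<^sup>2\<close> integrand does not provide.\<close>

lemma integral_primitive_mult:
  fixes h g k :: "real \<Rightarrow> complex"
  assumes ab: "a \<le> b"
    and h: "integrable (lebesgue_on {a<..<b}) h"
    and g: "\<And>x. x \<in> {a..b} \<Longrightarrow> (g has_vector_derivative k x) (at x within {a..b})"
    and k: "continuous_on {a..b} k"
  shows "integral\<^sup>L (lebesgue_on {a<..<b}) (\<lambda>x. integral {a..x} h * k x) =
    integral\<^sup>L (lebesgue_on {a<..<b}) (\<lambda>x. h x * (g b - g x))"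
proof -
  define M where "M = lebesgue_on {a<..<b}"
  interpret finite_measure M
    unfolding M_def by (rule finite_measure_lebesgue_on) auto
  interpret pair_sigma_finite M M ..
  have idm [measurable]: "(\<lambda>x. x) \<in> borel_measurable M"
    using id_borel_measurable_lebesgue_on[of "{a<..<b}"] by (simp add: M_def id_def)
  have hM: "integrable M h"
    using h by (simp add: M_def)
  have hm [measurable]: "h \<in> borel_measurable M"
    using hM by simp
  have kI: "integrable M k"
    unfolding M_def by (rule continuous_on_integrable[OF k])
  have km [measurable]: "k \<in> borel_measurable M"
    using kI by simp
  \<comment> \<open>The product without the constraint \<open>t \<le> x\<close> dominates the
    integrand on the triangle, which is the one whose order of integration is exchanged.\<close>
  have prod: "integrable (M \<Otimes>\<^sub>M M) (\<lambda>p. h (snd p) * k (fst p))"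
  proof (rule Fubini_integrable)
    show "integrable M (\<lambda>x. \<integral>y. norm (h (snd (x, y)) * k (fst (x, y))) \<partial>M)"
      using kI by (simp add: norm_mult)
    show "AE x in M. integrable M (\<lambda>y. h (snd (x, y)) * k (fst (x, y)))"
      using hM by simp
  qed measurable
  have int: "integrable (M \<Otimes>\<^sub>M M) (case_prod (\<lambda>x t. if t \<le> x then h t * k x else 0))"
    unfolding case_prod_beta
  proof (rule Bochner_Integration.integrable_bound[OF prod])
    show "(\<lambda>p. if snd p \<le> fst p then h (snd p) * k (fst p) else 0) \<in> borel_measurable (M \<Otimes>\<^sub>M M)"
      by measurable
  qed auto
  \<comment> \<open>Fubini works over the fixed measure \<open>M\<close> with a cut-off integrand,
    while the claim has integrals over closed intervals; the two domains differ only by an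
    endpoint.\<close>
  have cut: "integral\<^sup>L M (\<lambda>t. if t \<in> S then \<phi> t else 0) = integral T \<phi>"
    if \<phi>: "integrable M \<phi>" and S: "S \<in> sets lebesgue"
      and N: "negligible (T - S \<inter> {a<..<b})" "S \<inter> {a<..<b} \<subseteq> T" for \<phi> :: "real \<Rightarrow> complex" and S T
  proof -
    have "integral\<^sup>L M (\<lambda>t. if t \<in> S then \<phi> t else 0) = integral\<^sup>L (lebesgue_on (S \<inter> {a<..<b})) \<phi>"
      unfolding M_def by (rule Lebesgue_Measure.integral_restrict_Int) (use S in auto)
    also have "\<dots> = integral (S \<inter> {a<..<b}) \<phi>"
    proof (rule lebesgue_integral_eq_integral)
      have "set_integrable lebesgue {a<..<b} \<phi>"
        using \<phi> by (simp add: M_def integrable_restrict_space set_integrable_def)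
      then have "set_integrable lebesgue (S \<inter> {a<..<b}) \<phi>"
        by (rule set_integrable_subset) (use S in auto)
      then show "integrable (lebesgue_on (S \<inter> {a<..<b})) \<phi>"
        using S by (subst integrable_restrict_space) (auto simp: set_integrable_def)
    qed (use S in auto)
    also have "\<dots> = integral T \<phi>"
    proof (rule integral_spike_set)
      show "negligible {x \<in> S \<inter> {a<..<b} - T. \<phi> x \<noteq> 0}"
        using N(2) by (metis (no_types, lifting) Diff_eq_empty_iff empty_Collect_eq empty_iff negligible_empty)
      show "negligible {x \<in> T - S \<inter> {a<..<b}. \<phi> x \<noteq> 0}"
        by (rule negligible_subset[OF N(1)]) auto
    qed
    finally show ?thesis .
  qed
  have "integral\<^sup>L M (\<lambda>x. integral {a..x} h * k x) =
      (\<integral>x. (\<integral>t. (if t \<le> x then h t * k x else 0) \<partial>M) \<partial>M)"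
  proof (rule Bochner_Integration.integral_cong)
    fix x assume "x \<in> space M"
    then have x: "a < x" "x < b" by (auto simp: M_def)
    have "integral {a..x} h = integral\<^sup>L M (\<lambda>t. if t \<in> {..x} then h t else 0)"
    proof (rule cut[OF hM, symmetric])
      have "{a..x} - {..x} \<inter> {a<..<b} \<subseteq> {a}" using x by auto
      then show "negligible ({a..x} - {..x} \<inter> {a<..<b})"
        using negligible_sing negligible_subset by blast
    qed (use x in auto)
    then have "integral {a..x} h * k x = integral\<^sup>L M (\<lambda>t. (if t \<in> {..x} then h t else 0) * k x)"
      by simp
    also have "\<dots> = integral\<^sup>L M (\<lambda>t. if t \<le> x then h t * k x else 0)"
      by (intro Bochner_Integration.integral_cong) auto
    finally show "integral {a..x} h * k x = integral\<^sup>L M (\<lambda>t. if t \<le> x then h t * k x else 0)" .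
  qed simp
  \<comment> \<open>After the exchange the inner integral runs over \<open>k\<close> on
    \<open>{t..b}\<close>, which the fundamental theorem evaluates to
    \<open>g b - g t\<close>.\<close>
  also have "\<dots> = (\<integral>t. (\<integral>x. (if t \<le> x then h t * k x else 0) \<partial>M) \<partial>M)"
    using Fubini_integral[OF int] by simp
  also have "\<dots> = integral\<^sup>L M (\<lambda>t. h t * (g b - g t))"
  proof (rule Bochner_Integration.integral_cong)
    fix t assume "t \<in> space M"
    then have t: "a < t" "t < b" by (auto simp: M_def)
    have "integral\<^sup>L M (\<lambda>x. if t \<le> x then h t * k x else 0) =
        integral\<^sup>L M (\<lambda>x. h t * (if x \<in> {t..} then k x else 0))"
      by (intro Bochner_Integration.integral_cong) auto
    also have "\<dots> = h t * integral\<^sup>L M (\<lambda>x. if x \<in> {t..} then k x else 0)"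
      by simp
    also have "integral\<^sup>L M (\<lambda>x. if x \<in> {t..} then k x else 0) = integral {t..b} k"
    proof (rule cut[OF kI])
      have "{t..b} - {t..} \<inter> {a<..<b} \<subseteq> {b}" using t by auto
      then show "negligible ({t..b} - {t..} \<inter> {a<..<b})"
        using negligible_sing negligible_subset by blast
    qed (use t in auto)
    also have "integral {t..b} k = g b - g t"
    proof (rule integral_unique, rule fundamental_theorem_of_calculus)
      fix x assume "x \<in> {t..b}"
      then show "(g has_vector_derivative k x) (at x within {t..b})"
        using t by (intro has_vector_derivative_within_subset[OF g]) auto
    qed (use t in auto)
    finally show "integral\<^sup>L M (\<lambda>x. if t \<le> x then h t * k x else 0) = h t * (g b - g t)" .
  qed simp
  finally show ?thesis by (simp add: M_def)
qed

lemma test_function_deriv: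
  assumes "test_function \<phi>"
  shows "(\<phi> has_real_derivative deriv \<phi> x) (at x)" "continuous_on S \<phi>" "continuous_on S (deriv \<phi>)"
    "\<phi> 0 = 0" "\<phi> 1 = 0"
proof -
  have d: "(deriv ^^ n) \<phi> field_differentiable at x" for n x
    using assms by (simp add: test_function_def)
  show "(\<phi> has_real_derivative deriv \<phi> x) (at x)"
    using d[of 0 x] by (simp add: field_differentiable_derivI)
  show "continuous_on S \<phi>"
    using d[of 0] by (auto simp: intro!: continuous_at_imp_continuous_on field_differentiable_imp_continuous_at)
  show "continuous_on S (deriv \<phi>)"
    using d[of 1] by (auto simp: intro!: continuous_at_imp_continuous_on field_differentiable_imp_continuous_at)
  have "x \<in> {0<..<1}" if "\<phi> x \<noteq> 0" for x
    using assms that closure_subset[of "{x. \<phi> x \<noteq> 0}"] by (auto simp: test_function_def)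
  from this[of 0] this[of 1] show "\<phi> 0 = 0" "\<phi> 1 = 0"
    by auto
qed

text \<open>Variation of constants: the solution of \<open>w' = p w + f\<close> with
  \<open>w 0 = C\<close>.\<close>

definition duhamel :: "complex \<Rightarrow> complex \<Rightarrow> (real \<Rightarrow> complex) \<Rightarrow> real \<Rightarrow> complex" where
  "duhamel p C f x = exp (p * of_real x) *
     (C + integral {0..x} (\<lambda>t. exp (- (p * of_real t)) * f t))"

lemma continuous_on_square_integrable:
  fixes k :: "real \<Rightarrow> complex"
  assumes "continuous_on {0..1} k"
  shows "square_integrable k"
proof -
  have "integrable (lebesgue_on {0<..<1}) (\<lambda>x. complex_of_real ((cmod (k x))\<^sup>2))"
    by (intro continuous_on_integrable continuous_intros assms)
  then have "integrable (lebesgue_on {0<..<1}) (\<lambda>x. (cmod (k x))\<^sup>2)"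
    by (simp only: complex_of_real_integrable_eq)
  then show ?thesis
    using continuous_on_integrable[OF assms] by (simp add: square_integrable_def)
qed

text \<open>The interval has finite measure, so \<open>1 + (cmod (f x))\<^sup>2\<close> is an
  integrable majorant.\<close>

lemma square_integrable_imp_integrable:
  assumes "square_integrable f"
  shows "integrable (lebesgue_on {0<..<1}) f"
proof (rule Bochner_Integration.integrable_bound)
  interpret finite_measure "lebesgue_on {0<..<1::real}"
    by (rule finite_measure_lebesgue_on) auto
  show "integrable (lebesgue_on {0<..<1}) (\<lambda>x. 1 + (cmod (f x))\<^sup>2)"
    using assms by (auto simp: square_integrable_def)
  have "r \<le> 1 + r\<^sup>2" for r :: real
    using zero_le_power2[of "r - 1/2"] by (simp add: power2_eq_square algebra_simps)
  then show "AE x in lebesgue_on {0<..<1}. norm (f x) \<le> norm (1 + (cmod (f x))\<^sup>2)"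
    by auto
qed (use assms in \<open>simp add: square_integrable_def\<close>)

lemma integrable_mult_continuous:
  fixes f k :: "real \<Rightarrow> complex"
  assumes f: "integrable (lebesgue_on {0<..<1}) f" and k: "continuous_on {0..1} k"
  shows "integrable (lebesgue_on {0<..<1}) (\<lambda>x. f x * k x)"
proof -
  obtain B where B: "\<And>x. x \<in> {0..1} \<Longrightarrow> norm (k x) \<le> B"
    using compact_imp_bounded[OF compact_continuous_image[OF k]] unfolding bounded_iff by fastforce
  show ?thesis
  proof (rule Bochner_Integration.integrable_bound)
    show "integrable (lebesgue_on {0<..<1}) (\<lambda>x. complex_of_real B * f x)"
      using f by simp
    show "AE x in lebesgue_on {0<..<1}. norm (f x * k x) \<le> norm (complex_of_real B * f x)"
    proof (intro AE_I2)
      fix x :: real assume "x \<in> space (lebesgue_on {0<..<1})"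
      then have "norm (k x) \<le> \<bar>B\<bar>" using B[of x] by auto
      then show "norm (f x * k x) \<le> norm (complex_of_real B * f x)"
        by (simp add: norm_mult mult_right_mono mult.commute[of "cmod (f x)"])
    qed
  qed (use f continuous_on_integrable[OF k] in measurable)
qed

lemma continuous_on_duhamel:
  assumes "integrable (lebesgue_on {0<..<1}) f"
  shows "continuous_on {0..1} (duhamel p C f)"
proof -
  have "integrable (lebesgue_on {0<..<1}) (\<lambda>t. f t * exp (- (p * of_real t)))"
    by (intro integrable_mult_continuous assms continuous_intros)
  then have "(\<lambda>t. exp (- (p * of_real t)) * f t) integrable_on {0..1}"
    using set_lebesgue_integral_eq_integral(1)[OF set_integrable_closed_interval]
    by (simp add: mult.commute)
  then show ?thesis
    unfolding duhamel_def by (intro continuous_intros indefinite_integral_continuous_1)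
qed

text \<open>This is the equation \<open>w' = p w + f\<close> in the weak sense. The exponential
  factor moves from \<open>w\<close> to the test function, which leaves an integration by parts for
  the primitive of \<open>h\<close> against \<open>g\<close>, where \<open>g\<close> vanishes at
  both ends.\<close>

lemma duhamel_weak_deriv:
  assumes f: "integrable (lebesgue_on {0<..<1}) f" and \<phi>: "test_function \<phi>"
  shows "integral\<^sup>L (lebesgue_on {0<..<1}) (\<lambda>x. duhamel p C f x * of_real (deriv \<phi> x)) =
    - integral\<^sup>L (lebesgue_on {0<..<1}) (\<lambda>x. (p * duhamel p C f x + f x) * of_real (\<phi> x))"
proof -
  note tf = test_function_deriv[OF \<phi>]
  define h where "h t = exp (- (p * of_real t)) * f t" for t :: real
  define g where "g x = exp (p * of_real x) * of_real (\<phi> x)" for x :: real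
  define k where "k x = exp (p * of_real x) * (p * of_real (\<phi> x) + of_real (deriv \<phi> x))" for x :: real
  let ?M = "lebesgue_on {0<..<1::real}"
  have h: "integrable ?M h"
    using integrable_mult_continuous[OF f, of "\<lambda>t. exp (- (p * of_real t))"]
    by (simp add: h_def[abs_def] mult.commute continuous_intros)
  have "((\<lambda>x. complex_of_real (\<phi> x)) has_vector_derivative of_real (deriv \<phi> x)) (at x within S)" for x S
    using tf(1)[of x] has_vector_derivative_of_real has_real_derivative_iff_has_vector_derivative
      has_vector_derivative_at_within by blast
  moreover have "((\<lambda>x. exp (p * of_real x)) has_vector_derivative exp (p * of_real x) * p) (at x within S)" for x S
    by (rule has_vector_derivative_real_field) (auto intro!: derivative_eq_intros)
  ultimately have g: "(g has_vector_derivative k x) (at x within S)" for x S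
    unfolding g_def[abs_def] k_def
    by (rule has_vector_derivative_eq_rhs[OF has_vector_derivative_mult[rotated]]) (simp add: algebra_simps)
  have k: "continuous_on {0..1} k"
    unfolding k_def by (intro continuous_intros tf)
  have g01: "g 0 = 0" "g 1 = 0"
    by (simp_all add: g_def tf)
  have F: "continuous_on {0..1} (\<lambda>x. integral {0..x} h)"
    using set_lebesgue_integral_eq_integral(1)[OF set_integrable_closed_interval[OF h]]
    by (rule indefinite_integral_continuous_1)
  \<comment> \<open>This removes the contribution of the initial value \<open>C\<close>.\<close>
  have ik: "integral\<^sup>L ?M k = 0"
  proof -
    have "integral\<^sup>L ?M k = integral {0<..<1} k"
      by (rule lebesgue_integral_eq_integral) (use continuous_on_integrable[OF k] in auto)
    also have "\<dots> = integral {0..1} k"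
      by (rule integral_open_interval_real[symmetric])
    also have "\<dots> = g 1 - g 0"
      by (intro integral_unique fundamental_theorem_of_calculus g) auto
    finally show ?thesis by (simp add: g01)
  qed
  have "integral\<^sup>L ?M (\<lambda>x. duhamel p C f x * of_real (deriv \<phi> x)) +
      integral\<^sup>L ?M (\<lambda>x. (p * duhamel p C f x + f x) * of_real (\<phi> x)) =
      integral\<^sup>L ?M (\<lambda>x. duhamel p C f x * of_real (deriv \<phi> x) + (p * duhamel p C f x + f x) * of_real (\<phi> x))"
  proof (rule Bochner_Integration.integral_add[symmetric])
    show "integrable ?M (\<lambda>x. duhamel p C f x * of_real (deriv \<phi> x))"
      by (intro continuous_on_integrable continuous_intros tf continuous_on_duhamel f)
    have "integrable ?M (\<lambda>x. p * duhamel p C f x + f x)"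
      by (intro Bochner_Integration.integrable_add f continuous_on_integrable continuous_intros
          continuous_on_duhamel)
    then show "integrable ?M (\<lambda>x. (p * duhamel p C f x + f x) * of_real (\<phi> x))"
      by (rule integrable_mult_continuous) (intro continuous_intros tf)
  qed
  \<comment> \<open>Here \<open>k\<close> is the derivative of \<open>g\<close>, and
    \<open>h x * g x\<close> equals \<open>f x\<close> times the test function because the
    exponentials cancel.\<close>
  also have "\<dots> = integral\<^sup>L ?M (\<lambda>x. C * k x + (integral {0..x} h * k x + h x * g x))"
  proof (rule Bochner_Integration.integral_cong)
    fix x
    have "f x = exp (p * of_real x) * h x"
      by (simp add: h_def mult.assoc[symmetric] exp_add[symmetric])
    then show "duhamel p C f x * of_real (deriv \<phi> x) + (p * duhamel p C f x + f x) * of_real (\<phi> x) =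
        C * k x + (integral {0..x} h * k x + h x * g x)"
      unfolding duhamel_def h_def[symmetric] k_def g_def by (simp add: algebra_simps)
  qed simp
  also have "\<dots> = C * integral\<^sup>L ?M k +
      (integral\<^sup>L ?M (\<lambda>x. integral {0..x} h * k x) + integral\<^sup>L ?M (\<lambda>x. h x * g x))"
  proof -
    have "integrable ?M (\<lambda>x. integral {0..x} h * k x)"
      by (intro continuous_on_integrable continuous_intros F k)
    moreover have "integrable ?M (\<lambda>x. h x * g x)"
      unfolding g_def by (intro integrable_mult_continuous h continuous_intros tf)
    ultimately show ?thesis
      using continuous_on_integrable[OF k] by simp
  qed
  also have "\<dots> = 0"
    using integral_primitive_mult[OF _ h g k] by (simp add: ik g01)
  finally show ?thesis
    by (simp add: add_eq_0_iff2)
qed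

subsection \<open>Classes of functions and the operator \<open>L\<^sub>0\<close>\<close>

lemma L2_rel_rep_abs:
  assumes "square_integrable u"
  shows "L2_rel (rep_L2c (abs_L2c u)) u"
  using assms by (intro Quotient_rep_abs[OF Quotient_L2c]) (simp add: L2_rel_def)

lemma AE_rep_abs_L2c:
  assumes "square_integrable u"
  shows "AE x in lebesgue_on {0<..<1}. rep_L2c (abs_L2c u) x = u x"
  using L2_rel_rep_abs[OF assms] by (simp add: L2_rel_def)

lemma scaleC_abs_L2c:
  "square_integrable u \<Longrightarrow> a *\<^sub>C abs_L2c u = abs_L2c (\<lambda>x. a * u x)"
  by (rule scaleC.abs_eq) (simp add: L2_rel_def)

lemma minus_abs_L2c:
  "square_integrable u \<Longrightarrow> square_integrable v \<Longrightarrow> abs_L2c u - abs_L2c v = abs_L2c (\<lambda>x. u x - v x)"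
  by (rule minus_L2c.abs_eq) (simp_all add: L2_rel_def)

lemma square_integrable_add:
  assumes "square_integrable u" "square_integrable v"
  shows "square_integrable (\<lambda>x. u x + v x)"
  using square_integrable_diff[OF assms(1) square_integrable_scale[OF assms(2), of "-1"]] by simp

text \<open>The counterpart of \<open>weak_deriv\<close> for concrete functions: linear combinations
  are differentiated here, before the passage to classes.\<close>

definition has_weak_deriv :: "(real \<Rightarrow> complex) \<Rightarrow> (real \<Rightarrow> complex) \<Rightarrow> bool" where
  "has_weak_deriv u v \<longleftrightarrow> (\<forall>\<phi>. test_function \<phi> \<longrightarrow>
     integral\<^sup>L (lebesgue_on {0<..<1}) (\<lambda>x. u x * of_real (deriv \<phi> x)) =
     - integral\<^sup>L (lebesgue_on {0<..<1}) (\<lambda>x. v x * of_real (\<phi> x)))"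

text \<open>The representative chosen by \<open>rep_L2c\<close> agrees with the given function
  almost everywhere, so integrals against continuous functions are unchanged.\<close>

lemma weak_deriv_abs_L2c:
  assumes u: "square_integrable u" and v: "square_integrable v" and d: "has_weak_deriv u v"
  shows "weak_deriv (abs_L2c u) (abs_L2c v)"
  unfolding weak_deriv_def
proof (intro allI impI)
  fix \<phi> assume \<phi>: "test_function \<phi>"
  have rep: "integral\<^sup>L (lebesgue_on {0<..<1}) (\<lambda>x. rep_L2c (abs_L2c w) x * of_real (\<psi> x)) =
      integral\<^sup>L (lebesgue_on {0<..<1}) (\<lambda>x. w x * of_real (\<psi> x))"
    if w: "square_integrable w" and \<psi>: "continuous_on {0..1} \<psi>" for w \<psi>
  proof (rule integral_cong_AE)
    have "integrable (lebesgue_on {0<..<1}) (\<lambda>x. v x * of_real (\<psi> x))" if "square_integrable v" for v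
      by (intro integrable_mult_continuous square_integrable_imp_integrable continuous_intros \<psi> that)
    then show "(\<lambda>x. rep_L2c (abs_L2c w) x * of_real (\<psi> x)) \<in> borel_measurable (lebesgue_on {0<..<1})"
      "(\<lambda>x. w x * of_real (\<psi> x)) \<in> borel_measurable (lebesgue_on {0<..<1})"
      using w L2_rel_rep_abs[OF w] by (simp_all add: L2_rel_def borel_measurable_integrable)
    show "AE x in lebesgue_on {0<..<1}. rep_L2c (abs_L2c w) x * of_real (\<psi> x) = w x * of_real (\<psi> x)"
      using AE_rep_abs_L2c[OF w] by eventually_elim simp
  qed
  show "integral\<^sup>L (lebesgue_on {0<..<1}) (\<lambda>x. rep_L2c (abs_L2c u) x * of_real (deriv \<phi> x)) =
      - integral\<^sup>L (lebesgue_on {0<..<1}) (\<lambda>x. rep_L2c (abs_L2c v) x * of_real (\<phi> x))"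
    using d \<phi> by (simp add: rep u v test_function_deriv has_weak_deriv_def)
qed

lemma has_weak_deriv_sum:
  assumes u: "\<And>k. k \<in> S \<Longrightarrow> integrable (lebesgue_on {0<..<1}) (u k)"
    and v: "\<And>k. k \<in> S \<Longrightarrow> integrable (lebesgue_on {0<..<1}) (v k)"
    and d: "\<And>k. k \<in> S \<Longrightarrow> has_weak_deriv (u k) (v k)"
  shows "has_weak_deriv (\<lambda>x. \<Sum>k\<in>S. c k * u k x) (\<lambda>x. \<Sum>k\<in>S. c k * v k x)"
  unfolding has_weak_deriv_def
proof (intro allI impI)
  fix \<phi> assume \<phi>: "test_function \<phi>"
  have lin: "integral\<^sup>L (lebesgue_on {0<..<1}) (\<lambda>x. (\<Sum>k\<in>S. c k * w k x) * of_real (\<psi> x)) =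
      (\<Sum>k\<in>S. c k * integral\<^sup>L (lebesgue_on {0<..<1}) (\<lambda>x. w k x * of_real (\<psi> x)))"
    if w: "\<And>k. k \<in> S \<Longrightarrow> integrable (lebesgue_on {0<..<1}) (w k)" and \<psi>: "continuous_on {0..1} \<psi>"
    for w and \<psi> :: "real \<Rightarrow> real"
  proof -
    have "integrable (lebesgue_on {0<..<1}) (\<lambda>x. w k x * of_real (\<psi> x))" if "k \<in> S" for k
      by (intro integrable_mult_continuous continuous_intros \<psi> w that)
    then show ?thesis
      by (simp add: sum_distrib_right mult.assoc)
  qed
  show "integral\<^sup>L (lebesgue_on {0<..<1}) (\<lambda>x. (\<Sum>k\<in>S. c k * u k x) * of_real (deriv \<phi> x)) =
      - integral\<^sup>L (lebesgue_on {0<..<1}) (\<lambda>x. (\<Sum>k\<in>S. c k * v k x) * of_real (\<phi> x))"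
    using d \<phi> by (simp add: lin u v test_function_deriv has_weak_deriv_def sum_negf)
qed

lemma periodic_boundary_abs_L2c:
  assumes "continuous_on {0..1} u" "u 1 = u 0"
  shows "periodic_boundary (abs_L2c u)"
  using assms AE_rep_abs_L2c[OF continuous_on_square_integrable[OF assms(1)]]
  unfolding periodic_boundary_def by blast

text \<open>The sums in the last two hypotheses are multiplied by \<open>f x\<close> so that the lemma also covers
  \<open>f = 0\<close> with arbitrary coefficients.\<close>

lemma L0_memI:
  assumes f: "square_integrable f"
    and per: "\<And>k. k \<in> S \<Longrightarrow> duhamel (p k) (C k) f 1 = duhamel (p k) (C k) f 0"
    and c0: "\<And>x. (\<Sum>k\<in>S. c k) * f x = 0"
    and c1: "\<And>x. (\<Sum>k\<in>S. c k * p k) * f x = 0"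
  shows "(abs_L2c (\<lambda>x. \<Sum>k\<in>S. c k * duhamel (p k) (C k) f x),
    \<i> *\<^sub>C abs_L2c (\<lambda>x. (\<Sum>k\<in>S. c k * p k ^ 3 * duhamel (p k) (C k) f x) + (\<Sum>k\<in>S. c k * p k ^ 2) * f x)) \<in> L0"
proof -
  let ?w = "\<lambda>k. duhamel (p k) (C k) f"
  \<comment> \<open>\<open>u j\<close> is the candidate for the \<open>j\<close>-th derivative: each
    differentiation multiplies the \<open>k\<close>-th term by \<open>p k\<close>.\<close>
  define u where "u j x = (\<Sum>k\<in>S. (c k * p k ^ j) * ?w k x)" for j :: nat and x
  have fi: "integrable (lebesgue_on {0<..<1}) f"
    by (rule square_integrable_imp_integrable[OF f])
  have cont: "continuous_on {0..1} (u j)" for j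
    unfolding u_def by (intro continuous_intros continuous_on_duhamel fi)
  have sq: "square_integrable (u j)" for j
    by (rule continuous_on_square_integrable[OF cont])
  \<comment> \<open>Differentiation also produces a multiple of \<open>f\<close>. Its coefficient is
    annihilated by \<open>c0\<close> for \<open>j = 0\<close> and by \<open>c1\<close> for
    \<open>j = 1\<close>; for \<open>j = 2\<close> it survives and is absorbed into
    \<open>u3\<close>.\<close>
  have d: "has_weak_deriv (u j) (\<lambda>x. u (Suc j) x + (\<Sum>k\<in>S. c k * p k ^ j) * f x)" for j
  proof -
    have "has_weak_deriv (u j) (\<lambda>x. \<Sum>k\<in>S. (c k * p k ^ j) * (p k * ?w k x + f x))"
      unfolding u_def
    proof (rule has_weak_deriv_sum)
      fix k
      show "integrable (lebesgue_on {0<..<1}) (?w k)"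
        by (intro continuous_on_integrable continuous_on_duhamel fi)
      then show "integrable (lebesgue_on {0<..<1}) (\<lambda>x. p k * ?w k x + f x)"
        using fi by simp
      show "has_weak_deriv (?w k) (\<lambda>x. p k * ?w k x + f x)"
        unfolding has_weak_deriv_def using duhamel_weak_deriv[OF fi] by blast
    qed
    also have "(\<lambda>x. \<Sum>k\<in>S. (c k * p k ^ j) * (p k * ?w k x + f x)) =
        (\<lambda>x. u (Suc j) x + (\<Sum>k\<in>S. c k * p k ^ j) * f x)"
      by (simp add: u_def fun_eq_iff sum_distrib_left sum_distrib_right sum.distrib algebra_simps)
    finally show ?thesis .
  qed
  define u3 where "u3 x = u 3 x + (\<Sum>k\<in>S. c k * p k ^ 2) * f x" for x
  have sq3: "square_integrable u3"
    unfolding u3_def by (intro square_integrable_add sq square_integrable_scale f)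
  have d01: "has_weak_deriv (u 0) (u 1)" and d12: "has_weak_deriv (u 1) (u 2)"
    using d[of 0] d[of 1] c0 c1 by (simp_all add: numeral_2_eq_2)
  have d23: "has_weak_deriv (u 2) u3"
    using d[of 2] by (simp add: u3_def[abs_def] numeral_3_eq_3)
  have "weak_deriv (abs_L2c (u 0)) (abs_L2c (u 1))" "weak_deriv (abs_L2c (u 1)) (abs_L2c (u 2))"
    "weak_deriv (abs_L2c (u 2)) (abs_L2c u3)"
    using weak_deriv_abs_L2c sq sq3 d01 d12 d23 by blast+
  moreover have "periodic_boundary (abs_L2c (u j))" for j
    by (intro periodic_boundary_abs_L2c cont) (simp add: u_def per)
  ultimately have "(abs_L2c (u 0), \<i> *\<^sub>C abs_L2c u3) \<in> L0"
    unfolding L0_def by blast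
  moreover have "u 0 = (\<lambda>x. \<Sum>k\<in>S. c k * ?w k x)"
    by (simp add: u_def fun_eq_iff)
  moreover have "u3 = (\<lambda>x. (\<Sum>k\<in>S. c k * p k ^ 3 * ?w k x) + (\<Sum>k\<in>S. c k * p k ^ 2) * f x)"
    by (simp add: u_def u3_def fun_eq_iff)
  ultimately show ?thesis
    by simp
qed

text \<open>Uniqueness off the spectrum reduces the computation of the resolvent to exhibiting one
  solution in the domain.\<close>

lemma resolvent_eqI:
  assumes "z \<notin> spectrum T" "(y, g) \<in> T" "g - z *\<^sub>C y = f"
  shows "resolvent T z f = y"
proof -
  have "\<exists>!y. \<exists>g. (y, g) \<in> T \<and> g - z *\<^sub>C y = f"
    using assms(1) by (simp add: spectrum_def resolvent_set_def)
  then show ?thesis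
    unfolding resolvent_def by (rule the1_equality) (use assms in blast)
qed

text \<open>\<open>exp (p * of_real x)\<close> is a periodic eigenfunction. Were the value in the
  resolvent set, all multiples of it would be the one preimage of zero and hence equal.\<close>

lemma L0_eigenvalue:
  assumes "exp p = 1"
  shows "\<i> * p ^ 3 \<in> spectrum L0"
proof (rule ccontr)
  assume z: "\<i> * p ^ 3 \<notin> spectrum L0"
  let ?e = "\<lambda>x::real. exp (p * of_real x)"
  have sq: "square_integrable (\<lambda>x. a * ?e x)" for a
    by (intro continuous_on_square_integrable continuous_intros)
  have "resolvent L0 (\<i> * p ^ 3) (abs_L2c (\<lambda>x. 0)) = abs_L2c (\<lambda>x. a * ?e x)" for a
  proof (rule resolvent_eqI[OF z])
    show "(abs_L2c (\<lambda>x. a * ?e x), \<i> *\<^sub>C abs_L2c (\<lambda>x. a * p ^ 3 * ?e x)) \<in> L0"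
      \<comment> \<open>With zero forcing term and a single index, \<open>duhamel\<close> reduces to
        \<open>a * exp (p * of_real x)\<close>.\<close>
      using L0_memI[OF square_integrable_zero, of "{0::nat}" "\<lambda>_. p" "\<lambda>_. 1" "\<lambda>_. a"] assms
      by (simp add: duhamel_def)
    have "\<i> *\<^sub>C abs_L2c (\<lambda>x. a * p ^ 3 * ?e x) - (\<i> * p ^ 3) *\<^sub>C abs_L2c (\<lambda>x. a * ?e x) =
        abs_L2c (\<lambda>x. \<i> * (a * p ^ 3 * ?e x) - \<i> * p ^ 3 * (a * ?e x))"
      by (simp only: scaleC_abs_L2c minus_abs_L2c square_integrable_scale sq)
    then show "\<i> *\<^sub>C abs_L2c (\<lambda>x. a * p ^ 3 * ?e x) - (\<i> * p ^ 3) *\<^sub>C abs_L2c (\<lambda>x. a * ?e x) =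
        abs_L2c (\<lambda>x. 0)"
      by (simp add: mult.assoc mult.left_commute)
  qed
  from this[of 1] this[of 0] have eq: "abs_L2c ?e = abs_L2c (\<lambda>x. 0)"
    by simp
  \<comment> \<open>The exponential never vanishes, so equality with the zero class would make an
    interval of length 1 a null set.\<close>
  have "AE x in lebesgue_on {0<..<1::real}. False"
    using AE_rep_abs_L2c[OF sq[of 1]] AE_rep_abs_L2c[OF square_integrable_zero]
    by eventually_elim (simp add: eq)
  then show False
    by (simp add: eventually_False ae_filter_eq_bot_iff emeasure_restrict_space)
qed

subsection \<open>Trigonometric identities and the resolvent kernel\<close>

lemma sum_1_3: "(\<Sum>k=1..3. h k) = h 1 + h 2 + h (3::nat)"
  by (simp add: numeral_3_eq_3 numeral_2_eq_2)

lemma \<omega>_cube: "\<omega> ^ 3 = 1"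
proof -
  have "\<omega> ^ 3 = exp (of_nat 3 * (2 * of_real pi * \<i> / 3))"
    unfolding \<omega>_def by (rule exp_of_nat_mult[symmetric])
  also have "of_nat 3 * (2 * of_real pi * \<i> / 3) = 2 * of_real pi * \<i>"
    by simp
  finally show ?thesis by (simp only: exp_two_pi_i)
qed

lemma \<omega>_sum: "1 + \<omega> + \<omega>\<^sup>2 = 0"
proof -
  have "\<omega> \<noteq> 1"
  proof
    assume "\<omega> = 1"
    then have "Im \<omega> = 0" by simp
    moreover have "Im \<omega> = sin (2 * pi / 3)" by (simp add: \<omega>_def Im_exp)
    moreover have "sin (2 * pi / 3) > 0" by (rule sin_gt_zero) auto
    ultimately show False by simp
  qed
  moreover have "(\<omega> - 1) * (1 + \<omega> + \<omega>\<^sup>2) = 0"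
    using \<omega>_cube by (simp add: algebra_simps power2_eq_square power3_eq_cube)
  ultimately show ?thesis by simp
qed

lemma \<omega>_nonzero: "\<omega> \<noteq> 0"
  by (simp add: \<omega>_def)

text \<open>The index 3 contributes \<open>exp z\<close> since \<open>\<omega> ^ 3 = 1\<close>;
  replacing inverses of \<open>\<omega>\<close> by powers makes later identities polynomial.\<close>

lemma c3_s3_d3_eq:
  "c3 z = (exp (\<omega> * z) + exp (\<omega>\<^sup>2 * z) + exp z) / 3"
  "s3 z = (\<omega>\<^sup>2 * exp (\<omega> * z) + \<omega> * exp (\<omega>\<^sup>2 * z) + exp z) / 3"
  "d3 z = (\<omega> * exp (\<omega> * z) + \<omega>\<^sup>2 * exp (\<omega>\<^sup>2 * z) + exp z) / 3"
proof -
  have inv: "1 / \<omega> = \<omega>\<^sup>2" "1 / \<omega>\<^sup>2 = \<omega>"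
    using \<omega>_cube \<omega>_nonzero by (simp_all add: field_simps power2_eq_square power3_eq_cube)
  show "c3 z = (exp (\<omega> * z) + exp (\<omega>\<^sup>2 * z) + exp z) / 3"
    "s3 z = (\<omega>\<^sup>2 * exp (\<omega> * z) + \<omega> * exp (\<omega>\<^sup>2 * z) + exp z) / 3"
    "d3 z = (\<omega> * exp (\<omega> * z) + \<omega>\<^sup>2 * exp (\<omega>\<^sup>2 * z) + exp z) / 3"
    unfolding c3_def s3_def d3_def sum_1_3 power_one_right inv \<omega>_cube by simp_all
qed

text \<open>Expanded into exponentials, each mixed product on the right has coefficient
  \<open>1 + \<omega> + \<omega>\<^sup>2 = 0\<close> after reduction by
  \<open>\<omega> ^ 3 = 1\<close>, and the three equal-index products appear three times.\<close>

lemma d3_add: "d3 (a + b) = d3 a * c3 b + s3 a * s3 b + c3 a * d3 b"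
proof -
  have "(w * (A1 * B1) + w\<^sup>2 * (A2 * B2) + A3 * B3) / 3 =
      (w * A1 + w\<^sup>2 * A2 + A3) / 3 * ((B1 + B2 + B3) / 3)
      + (w\<^sup>2 * A1 + w * A2 + A3) / 3 * ((w\<^sup>2 * B1 + w * B2 + B3) / 3)
      + (A1 + A2 + A3) / 3 * ((w * B1 + w\<^sup>2 * B2 + B3) / 3)"
    if w: "1 + w + w\<^sup>2 = 0" for w A1 A2 A3 B1 B2 B3 :: complex
  proof -
    have e: "3 * (w * (A1 * B1) + w\<^sup>2 * (A2 * B2) + A3 * B3) =
        (w * A1 + w\<^sup>2 * A2 + A3) * (B1 + B2 + B3)
        + (w\<^sup>2 * A1 + w * A2 + A3) * (w\<^sup>2 * B1 + w * B2 + B3)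
        + (A1 + A2 + A3) * (w * B1 + w\<^sup>2 * B2 + B3)"
      using w by algebra
    then show ?thesis
      unfolding times_divide_times_eq add_divide_distrib[symmetric] e[symmetric] by simp
  qed
  from this[OF \<omega>_sum] show ?thesis
    unfolding c3_s3_d3_eq distrib_left exp_add by blast
qed

lemma K_eq: "K l x t = d3 (\<i> * l * of_real (x - t - 1)) + d3 (\<i> * l * of_real (x - t + 1))"
proof -
  have "\<i> * l * of_real (x - t - 1) = - \<i> * l * of_real t + \<i> * l * of_real (x - 1)"
    "\<i> * l * of_real (x - t + 1) = \<i> * l * of_real x + \<i> * l * of_real (1 - t)"
    by (simp_all add: algebra_simps)
  then show ?thesis
    by (simp only: K_def d3_add) (simp add: add.assoc)
qed

text \<open>The three exponents add up to zero. Hence the roots have product 1, and the product of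
  two of them is the inverse of the third, which turns the second symmetric function into
  \<open>3 * c3 (- z)\<close>.\<close>

lemma prod_exp_\<omega>:
  fixes X z :: complex
  shows "(X - exp (\<omega> * z)) * (X - exp (\<omega>\<^sup>2 * z)) * (X - exp z) =
    X ^ 3 - 3 * c3 z * X\<^sup>2 + 3 * c3 (- z) * X - 1"
proof -
  have third: "3 * (S / 3) = S" for S :: complex
    by simp
  have s: "\<omega> * z + \<omega>\<^sup>2 * z + z = 0"
    using \<omega>_sum by (metis add.commute add.assoc distrib_right mult_1 mult_zero_left)
  have "exp (\<omega> * z) * exp (\<omega>\<^sup>2 * z) * exp z = 1"
    by (simp add: exp_add[symmetric] s)
  moreover have "exp (\<omega> * - z) = exp (\<omega>\<^sup>2 * z) * exp z"
    unfolding exp_add[symmetric] by (rule arg_cong[where f = exp]) (use s in algebra)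
  moreover have "exp (\<omega>\<^sup>2 * - z) = exp (\<omega> * z) * exp z"
    unfolding exp_add[symmetric] by (rule arg_cong[where f = exp]) (use s in algebra)
  moreover have "exp (- z) = exp (\<omega> * z) * exp (\<omega>\<^sup>2 * z)"
    unfolding exp_add[symmetric] by (rule arg_cong[where f = exp]) (use s in algebra)
  moreover have "(X - a) * (X - b) * (X - c) =
      X ^ 3 - 3 * ((a + b + c) / 3) * X\<^sup>2 + 3 * ((b * c + a * c + a * b) / 3) * X - a * b * c" for a b c
    unfolding third by (simp add: algebra_simps power2_eq_square power3_eq_cube)
  ultimately show ?thesis
    unfolding c3_s3_d3_eq by metis
qed

lemma \<Delta>\<^sub>0_nonzero:
  assumes "l ^ 3 \<notin> spectrum L0"
  shows "\<Delta>\<^sub>0 l \<noteq> 0"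
proof
  assume "\<Delta>\<^sub>0 l = 0"
  then have "(1 - exp (\<omega> * (\<i> * l))) * (1 - exp (\<omega>\<^sup>2 * (\<i> * l))) * (1 - exp (\<i> * l)) = 0"
    unfolding prod_exp_\<omega> by (simp add: \<Delta>\<^sub>0_def)
  then consider "exp (\<omega> * (\<i> * l)) = 1" | "exp (\<omega>\<^sup>2 * (\<i> * l)) = 1" | "exp (\<i> * l) = 1"
    by auto
  \<comment> \<open>All three exponents have the same cube \<open>(\<i> * l) ^ 3\<close>, and
    \<open>\<i> ^ 4 = 1\<close>, so each of them gives the eigenvalue \<open>l ^ 3\<close>.\<close>
  moreover have "\<omega> ^ 6 = 1"
    using power_mult[of \<omega> 3 2] \<omega>_cube by simp
  then have "\<i> * (\<omega> * (\<i> * l)) ^ 3 = l ^ 3" "\<i> * (\<omega>\<^sup>2 * (\<i> * l)) ^ 3 = l ^ 3" "\<i> * (\<i> * l) ^ 3 = l ^ 3"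
    using \<omega>_cube by (simp_all add: power_mult_distrib power_mult[symmetric] power3_eq_cube[of \<i>])
  ultimately show False
    using L0_eigenvalue assms by metis
qed

text \<open>The eigenfunction is constant. This excludes \<open>l = 0\<close> in the resolvent
  formula.\<close>

lemma zero_in_spectrum_L0: "0 \<in> spectrum L0"
  using L0_eigenvalue[of 0] by simp

lemma char_poly_exp_\<omega>:
  fixes z :: complex
  assumes "k \<in> {1..3}"
  defines "e \<equiv> exp (\<omega> ^ k * z)"
  shows "e ^ 3 - 3 * c3 z * e\<^sup>2 + 3 * c3 (- z) * e - 1 = 0"
proof -
  have "k = 1 \<or> k = 2 \<or> k = 3"
    using assms(1) by auto
  then show ?thesis
    unfolding prod_exp_\<omega>[symmetric] by (auto simp: e_def \<omega>_cube)
qed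

lemma d3_eq_sum: "d3 (z * y) = (\<Sum>k=1..3. \<omega> ^ k / 3 * exp (\<omega> ^ k * z * y))"
  by (simp add: d3_def sum_distrib_left mult.assoc)

text \<open>Each exponential in the kernel separates into a factor in \<open>x\<close> and a factor
  in \<open>t\<close>. The summands \<open>exp (- p k)\<close> and \<open>exp (p k)\<close> come
  from the shifts by -1 and 1 in \<open>K_eq\<close>; \<open>B\<close> and \<open>S\<close> stay
  free to serve both integrals of the formula.\<close>

lemma set_integral_kernel:
  fixes l B :: complex and x :: real
  defines "p \<equiv> \<lambda>k::nat. \<omega> ^ k * (\<i> * l)"
  assumes f: "integrable (lebesgue_on {0<..<1}) f" and S: "S \<subseteq> {0..1}" "S \<in> sets lebesgue"
  shows "(LINT t:S|lebesgue. (d3 (\<i> * l * of_real (x - t)) * B + K l x t) * f t) =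
    (\<Sum>k=1..3. \<omega> ^ k / 3 * exp (p k * of_real x) * (B + exp (- p k) + exp (p k)) *
      integral S (\<lambda>t. exp (- (p k * of_real t)) * f t))"
proof -
  define h where "h k t = exp (- (p k * of_real t)) * f t" for k and t :: real
  have h: "set_integrable lebesgue S (h k)" for k
  proof -
    have "integrable (lebesgue_on {0<..<1}) (h k)"
      using integrable_mult_continuous[OF f, of "\<lambda>t. exp (- (p k * of_real t))"]
      by (simp add: h_def[abs_def] mult.commute continuous_intros)
    then show ?thesis
      by (rule set_integrable_subset[OF set_integrable_closed_interval S(2,1)])
  qed
  have "(d3 (\<i> * l * of_real (x - t)) * B + K l x t) * f t =
      (\<Sum>k=1..3. \<omega> ^ k / 3 * exp (p k * of_real x) * (B + exp (- p k) + exp (p k)) * h k t)" for t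
  proof -
    have e: "exp (\<omega> ^ k * (\<i> * l) * of_real (x - t)) = exp (p k * of_real x) * exp (- (p k * of_real t))"
      "exp (\<omega> ^ k * (\<i> * l) * of_real (x - t - 1)) = exp (p k * of_real x) * exp (- (p k * of_real t)) * exp (- p k)"
      "exp (\<omega> ^ k * (\<i> * l) * of_real (x - t + 1)) = exp (p k * of_real x) * exp (- (p k * of_real t)) * exp (p k)" for k
      by (simp_all add: p_def exp_add[symmetric] algebra_simps)
    show ?thesis
      unfolding K_eq d3_eq_sum e h_def sum_1_3
      by (simp add: algebra_simps add_divide_distrib)
  qed
  then have "(LINT t:S|lebesgue. (d3 (\<i> * l * of_real (x - t)) * B + K l x t) * f t) =
      (LINT t:S|lebesgue. (\<Sum>k=1..3. \<omega> ^ k / 3 * exp (p k * of_real x) * (B + exp (- p k) + exp (p k)) * h k t))"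
    by simp
  also have "\<dots> = (\<Sum>k=1..3. \<omega> ^ k / 3 * exp (p k * of_real x) * (B + exp (- p k) + exp (p k)) *
      (LINT t:S|lebesgue. h k t))"
    unfolding sum_1_3 using h by (simp add: set_integral_add)
  also have "\<dots> = (\<Sum>k=1..3. \<omega> ^ k / 3 * exp (p k * of_real x) * (B + exp (- p k) + exp (p k)) *
      integral S (h k))"
    using set_lebesgue_integral_eq_integral(2)[OF h] by simp
  finally show ?thesis by (simp add: h_def[abs_def])
qed

theorem lemma3p5:
  fixes l :: complex and f :: "real \<Rightarrow> complex"
  assumes "l ^ 3 \<notin> spectrum L0"
    and "square_integrable f"
  shows "AE x in lebesgue_on {0<..<1}.
    rep_L2c (resolvent L0 (l ^ 3) (abs_L2c f)) x =
      - \<i> / (l\<^sup>2 * \<Delta>\<^sub>0 l) *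
        (LINT t:{0..x}|lebesgue.
          (d3 (\<i> * l * of_real (x - t)) * (1 - 3 * c3 (\<i> * l)) + K l x t) * f t) +
      - \<i> / (l\<^sup>2 * \<Delta>\<^sub>0 l) *
        (LINT t:{x..1}|lebesgue.
          (d3 (\<i> * l * of_real (x - t)) * (1 - 3 * c3 (- \<i> * l)) + K l x t) * f t)"
proof -
  define \<mu> where "\<mu> = \<i> * l"
  define D where "D = \<Delta>\<^sub>0 l"
  define \<kappa> where "\<kappa> = - \<i> / (l\<^sup>2 * D)"
  define p where "p k = \<omega> ^ k * \<mu>" for k :: nat
  define c where "c k = \<kappa> * \<omega> ^ k / 3" for k :: nat
  define I where "I k S = integral S (\<lambda>t. exp (- (p k * of_real t)) * f t)" for k and S :: "real set"
  \<comment> \<open>\<open>a k\<close> and \<open>b k\<close> are the coefficients from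
    \<open>set_integral_kernel\<close> for the integrals over \<open>{x..1}\<close> and
    \<open>{0..x}\<close> respectively.\<close>
  define a where "a k = 1 - 3 * c3 (- \<mu>) + exp (- p k) + exp (p k)" for k
  define b where "b k = 1 - 3 * c3 \<mu> + exp (- p k) + exp (p k)" for k
  \<comment> \<open>As \<open>b k = a k - D\<close>, the coefficient drops by \<open>D\<close> from
    the right integral to the left one. This forces the forcing term \<open>- D * f x\<close> and
    the initial value \<open>a k * I k {0..1}\<close>.\<close>
  define g where "g x = - D * f x" for x
  define w where "w k = duhamel (p k) (a k * I k {0..1}) g" for k
  define u where "u x = (\<Sum>k=1..3. c k * w k x)" for x
  define v where "v x = (\<Sum>k=1..3. c k * p k ^ 3 * w k x) + (\<Sum>k=1..3. c k * p k ^ 2) * g x" for x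
  have D: "D \<noteq> 0"
    using \<Delta>\<^sub>0_nonzero assms(1) by (simp add: D_def)
  have l: "l \<noteq> 0"
    using zero_in_spectrum_L0 assms(1) by auto
  have neg: "- \<i> * l = - \<mu>"
    by (simp add: \<mu>_def)
  have b: "b k = a k - D" for k
    by (simp add: a_def b_def D_def \<Delta>\<^sub>0_def neg \<mu>_def)
  have gs: "square_integrable g"
    unfolding g_def by (rule square_integrable_scale[OF assms(2)])
  have fi: "integrable (lebesgue_on {0<..<1}) f"
    by (rule square_integrable_imp_integrable[OF assms(2)])
  have wx: "w k x = exp (p k * of_real x) * (a k * I k {0..1} - D * I k {0..x})" for k x
  proof -
    have "integral {0..x} (\<lambda>t. exp (- (p k * of_real t)) * g t) = - D * I k {0..x}"
      unfolding I_def g_def integral_mult_right[symmetric] by (simp add: mult.left_commute)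
    then show ?thesis
      by (simp add: w_def duhamel_def)
  qed
  have per: "w k 1 = w k 0" if "k \<in> {1..3}" for k
  proof -
    \<comment> \<open>This is the periodicity condition up to the factor \<open>I k {0..1}\<close>;
      multiplied by the nonzero \<open>exp (p k)\<close> it becomes the cubic evaluated at its root
      \<open>exp (p k)\<close>.\<close>
    have "exp (p k) * b k - a k = 0"
    proof -
      have "exp (p k) * (exp (p k) * b k - a k) =
          exp (p k) ^ 3 - 3 * c3 \<mu> * exp (p k) ^ 2 + 3 * c3 (- \<mu>) * exp (p k) - 1"
        by (simp add: a_def b_def algebra_simps power2_eq_square power3_eq_cube exp_minus_inverse
            exp_minus)
      also have "\<dots> = 0"
        unfolding p_def by (rule char_poly_exp_\<omega>[OF that])
      finally show ?thesis by simp
    qed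
    then have "exp (p k) * (a k - D) = a k"
      by (simp add: b)
    moreover have "w k 1 = exp (p k) * (a k - D) * I k {0..1}" "w k 0 = a k * I k {0..1}"
      by (simp_all add: wx algebra_simps) (simp add: I_def)
    ultimately show ?thesis by simp
  qed
  have \<omega>_powers: "\<omega> ^ 4 = \<omega>" "\<omega> ^ 6 = 1" "\<omega> * \<omega> = \<omega>\<^sup>2"
    using \<omega>_cube power_add[of \<omega> 3 1] power_add[of \<omega> 3 3] by (simp_all add: power2_eq_square)
  have \<omega>': "\<omega> + \<omega>\<^sup>2 + 1 = 0"
    using \<omega>_sum by (simp add: algebra_simps)
  have "(\<Sum>k=1..3. c k) = \<kappa> / 3 * (\<omega> + \<omega>\<^sup>2 + 1)"
    unfolding sum_1_3 by (simp add: c_def \<omega>_cube algebra_simps add_divide_distrib)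
  then have c0: "(\<Sum>k=1..3. c k) = 0"
    by (simp add: \<omega>')
  have "(\<Sum>k=1..3. c k * p k) = \<kappa> * \<mu> / 3 * (\<omega> + \<omega>\<^sup>2 + 1)"
    unfolding sum_1_3
    by (simp add: c_def p_def \<omega>_cube \<omega>_powers algebra_simps add_divide_distrib flip: power_add power_mult)
  then have c1: "(\<Sum>k=1..3. c k * p k) = 0"
    by (simp add: \<omega>')
  \<comment> \<open>The three powers of \<open>\<omega>\<close> combine to a power of
    \<open>\<omega> ^ 3 = 1\<close>, so the terms do not cancel as in the two preceding
    sums.\<close>
  have "c k * p k ^ 2 = \<kappa> * \<mu>\<^sup>2 / 3 * (\<omega> ^ 3) ^ k" for k
    by (simp add: c_def p_def power_mult_distrib power2_eq_square power3_eq_cube)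
  then have c_p2: "c k * p k ^ 2 = \<kappa> * \<mu>\<^sup>2 / 3" for k
    by (simp only: \<omega>_cube power_one mult_1_right)
  have c2_sum: "(\<Sum>k=1..3. c k * p k ^ 2) = \<kappa> * \<mu>\<^sup>2"
    unfolding c_p2 by simp
  \<comment> \<open>Since \<open>\<kappa> * \<mu>\<^sup>2 = \<i> / D\<close>, the prefactor is
    exactly the one for which the factor \<open>\<i>\<close> of the operator turns this term into
    \<open>f x\<close>.\<close>
  have c2: "(\<Sum>k=1..3. c k * p k ^ 2) * g x = - \<i> * f x" for x
    unfolding c2_sum using D l by (simp add: \<kappa>_def \<mu>_def g_def power_mult_distrib)
  have p3: "p k ^ 3 = \<mu> ^ 3" for k
    using \<omega>_cube by (simp add: p_def power_mult_distrib power_mult[symmetric] mult.commute[of k 3] power_mult[of \<omega> 3 k])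
  \<comment> \<open>The common cube of the \<open>p k\<close> makes the third derivative a multiple
    of \<open>u\<close> up to the term in \<open>f\<close>, and
    \<open>\<i> * \<mu> ^ 3 = l ^ 3\<close>.\<close>
  have v: "v x = \<mu> ^ 3 * u x - \<i> * f x" for x
    unfolding v_def u_def p3 c2 by (simp add: sum_distrib_left mult.assoc mult.left_commute)
  have us: "square_integrable u"
    unfolding u_def w_def
    by (intro continuous_on_square_integrable continuous_intros continuous_on_duhamel
        square_integrable_imp_integrable gs)
  then have vs: "square_integrable v"
    unfolding v[abs_def] by (intro square_integrable_diff square_integrable_scale assms(2))
  have "resolvent L0 (l ^ 3) (abs_L2c f) = abs_L2c u"
  proof (rule resolvent_eqI[OF assms(1)])
    show "(abs_L2c u, \<i> *\<^sub>C abs_L2c v) \<in> L0"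
      unfolding u_def[abs_def] v_def[abs_def] w_def
      by (rule L0_memI[OF gs]) (use per c0 c1 in \<open>simp_all add: w_def\<close>)
    have "\<i> *\<^sub>C abs_L2c v - l ^ 3 *\<^sub>C abs_L2c u = abs_L2c (\<lambda>x. \<i> * v x - l ^ 3 * u x)"
      by (simp only: scaleC_abs_L2c minus_abs_L2c square_integrable_scale us vs)
    also have "(\<lambda>x. \<i> * v x - l ^ 3 * u x) = f"
      by (simp add: v \<mu>_def fun_eq_iff power3_eq_cube algebra_simps)
    finally show "\<i> *\<^sub>C abs_L2c v - l ^ 3 *\<^sub>C abs_L2c u = abs_L2c f" .
  qed
  then have "AE x in lebesgue_on {0<..<1}. rep_L2c (resolvent L0 (l ^ 3) (abs_L2c f)) x = u x"
    using AE_rep_abs_L2c[OF us] by simp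
  then show ?thesis
  proof (rule lebesgue_on_mono)
    fix x :: real
    assume rep: "rep_L2c (resolvent L0 (l ^ 3) (abs_L2c f)) x = u x" and x: "x \<in> {0<..<1}"
    have split: "I k {0..1} = I k {0..x} + I k {x..1}" for k
    proof -
      have "integrable (lebesgue_on {0<..<1}) (\<lambda>t. exp (- (p k * of_real t)) * f t)"
        using integrable_mult_continuous[OF fi, of "\<lambda>t. exp (- (p k * of_real t))"]
        by (simp add: mult.commute continuous_intros)
      then have "(\<lambda>t. exp (- (p k * of_real t)) * f t) integrable_on {0..1}"
        by (rule set_lebesgue_integral_eq_integral(1)[OF set_integrable_closed_interval])
      then show ?thesis
        unfolding I_def using x by (intro Henstock_Kurzweil_Integration.integral_combine[symmetric]) auto
    qed
    \<comment> \<open>Splitting \<open>I k {0..1}\<close> at \<open>x\<close> turns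
      \<open>a k * I k {0..1} - D * I k {0..x}\<close> into
      \<open>b k * I k {0..x} + a k * I k {x..1}\<close>.\<close>
    have "u x = (\<Sum>k=1..3. \<kappa> * (\<omega> ^ k / 3 * exp (p k * of_real x) * b k * I k {0..x}) +
        \<kappa> * (\<omega> ^ k / 3 * exp (p k * of_real x) * a k * I k {x..1}))"
      unfolding u_def
    proof (rule sum.cong)
      fix k
      show "c k * w k x = \<kappa> * (\<omega> ^ k / 3 * exp (p k * of_real x) * b k * I k {0..x}) +
        \<kappa> * (\<omega> ^ k / 3 * exp (p k * of_real x) * a k * I k {x..1})"
        by (simp add: c_def wx b split algebra_simps add_divide_distrib diff_divide_distrib)
    qed simp
    also have "\<dots> = \<kappa> * (\<Sum>k=1..3. \<omega> ^ k / 3 * exp (p k * of_real x) * b k * I k {0..x}) +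
        \<kappa> * (\<Sum>k=1..3. \<omega> ^ k / 3 * exp (p k * of_real x) * a k * I k {x..1})"
      by (simp only: sum.distrib sum_distrib_left)
    also have "(\<Sum>k=1..3. \<omega> ^ k / 3 * exp (p k * of_real x) * b k * I k {0..x}) =
        (LINT t:{0..x}|lebesgue. (d3 (\<i> * l * of_real (x - t)) * (1 - 3 * c3 (\<i> * l)) + K l x t) * f t)"
      using x by (subst set_integral_kernel[OF fi]) (auto simp: b_def I_def p_def \<mu>_def)
    also have "(\<Sum>k=1..3. \<omega> ^ k / 3 * exp (p k * of_real x) * a k * I k {x..1}) =
        (LINT t:{x..1}|lebesgue. (d3 (\<i> * l * of_real (x - t)) * (1 - 3 * c3 (- \<i> * l)) + K l x t) * f t)"
      using x by (subst set_integral_kernel[OF fi]) (auto simp: a_def I_def p_def \<mu>_def)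
    finally show "rep_L2c (resolvent L0 (l ^ 3) (abs_L2c f)) x =
      - \<i> / (l\<^sup>2 * \<Delta>\<^sub>0 l) *
        (LINT t:{0..x}|lebesgue.
          (d3 (\<i> * l * of_real (x - t)) * (1 - 3 * c3 (\<i> * l)) + K l x t) * f t) +
      - \<i> / (l\<^sup>2 * \<Delta>\<^sub>0 l) *
        (LINT t:{x..1}|lebesgue.
          (d3 (\<i> * l * of_real (x - t)) * (1 - 3 * c3 (- \<i> * l)) + K l x t) * f t)"
      by (simp only: rep \<kappa>_def D_def)
  qed
qed

end
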